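(* For every figure $\mathcal{T}(n)$ (as defined in the context, with lines $k,l$ meeting at $A$, circle $\gamma$ of radius $r$ touching $k$ at $K$, and circles $\delta_1,\delta_2$ of radii $d_1\ge d_2$), the following hold. (i) If $n\neq\overline{0}$, then $d_1=\left(\sqrt{2n}+1\right)^2 r$ and $d_2=\left(\sqrt{2n}-1\right)^2 r$. (ii) $|AK|=\sqrt{d_1d_2}$. (iii) $\sqrt{r}=\dfrac{\sqrt{d_1}+\sqrt{d_2}}{2}$ if $0\le n\le 1/2$ (with $n\ne\overline{0}$), and $\sqrt{r}=\dfrac{\sqrt{d_1}-\sqrt{d_2}}{2}$ if $1/2<n$ or $n=\overline{0}$.
   Context: All objects are in the Euclidean plane. The figure $\mathcal{T}(n)$ is defined as follows. Let $k$ and $l$ be perpendicular lines intersecting at a point $A$, and let $\gamma$ be a circle of radius $r>0$ touching $k$ at a point $K$. Let $\delta_1$ and $\delta_2$ be the circles, of radii $d_1$ and $d_2$ with $d_2\le d_1$, that touch $l$ from the same (one fixed) side of $l$, touch $k$ from the same side as $\gamma$, and touch $\gamma$ externally (it is part of the configuration that such circles exist). They are the two distinct such circles, except that $\delta_1=\delta_2$ when there is only one; this happens exactly when $\gamma$ is the reflection of $\delta_1$ in $l$ (the case $n=0$ below). If $\gamma$ touches $k$ at $A$ (i.e. $K=A$), then $\delta_1$ is the circle touching $k$, $l$ and $\gamma$ externally (on the fixed side of $l$ and on the same side of $k$ as $\gamma$), and $\delta_2$ is the point $A$ with $d_2=0$. Put $$n=\frac{\tau|AK|}{2r}+\frac12,$$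 where $\tau=1$ if $\delta_1$ and $K$ lie on the same side of $l$ and $\tau=-1$ otherwise (so $n=1/2$ iff $K=A$). The figure consisting of $k,l,\gamma,\delta_1,\delta_2$ is denoted $\mathcal{T}(n)$. One has $n\ge 0$. Degenerate case: $\gamma$ may also degenerate to a point $K\ne A$ on $k$ (so $r=0$); then $\delta_1$ and $\delta_2$ coincide and are the circle touching $l$ (from the fixed side) and touching $k$ at $K$. This figure is denoted $\mathcal{T}(\overline{0})$, i.e. $n$ is the symbol $\overline{0}$, a label distinct from $0$ whose numerical value is defined to be $0$. A condition such as $0\le n\le 1/2$ refers to real $n$, i.e. to non-degenerate $\gamma$. *)

theory Defs
  imports "HOL-Analysis.Analysis"
begin

type_synonym point = "real ^ 2"

definition is_line :: "point set \<Rightarrow> bool" where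
  "is_line L \<longleftrightarrow> affine L \<and> aff_dim L = 1"

definition perpendicular :: "point set \<Rightarrow> point set \<Rightarrow> bool" where
  "perpendicular k l \<longleftrightarrow>
     (\<forall>x\<in>k. \<forall>x'\<in>k. \<forall>y\<in>l. \<forall>y'\<in>l. orthogonal (x - x') (y - y'))"

text \<open>
  The radius is not constrained by the type; radius 0 encodes a circle that has degenerated to its
  centre. Whether a circle is proper or degenerate is always stated explicitly below.
\<close>

datatype circle = Circle (centre: point) (radius: real)

definition points :: "circle \<Rightarrow> point set" where
  "points \<gamma> = sphere (centre \<gamma>) (radius \<gamma>)"

definition touches_line_at :: "circle \<Rightarrow> point set \<Rightarrow> point \<Rightarrow> bool" where
  "touches_line_at \<gamma> L P \<longleftrightarrow> points \<gamma> \<inter> L = {P}"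

definition touches_line :: "circle \<Rightarrow> point set \<Rightarrow> bool" where
  "touches_line \<gamma> L \<longleftrightarrow> (\<exists>P. touches_line_at \<gamma> L P)"

definition touches_externally :: "circle \<Rightarrow> circle \<Rightarrow> bool" where
  "touches_externally \<gamma> \<delta> \<longleftrightarrow>
     (\<exists>P. points \<gamma> \<inter> points \<delta> = {P}) \<and>
     ball (centre \<gamma>) (radius \<gamma>) \<inter> ball (centre \<delta>) (radius \<delta>) = {}"

text \<open>
  The sides of a line are the two open half-planes, i.e. the components of its complement.
  A figure on a side may meet the line itself, as a touching circle does.
\<close>

definition on_side :: "point set \<Rightarrow> point set \<Rightarrow> point set \<Rightarrow> bool" where
  "on_side L H S \<longleftrightarrow> H \<in> components (- L) \<and> S \<subseteq> H \<union> L"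

definition same_side :: "point set \<Rightarrow> point set \<Rightarrow> point set \<Rightarrow> bool" where
  "same_side L S T \<longleftrightarrow> (\<exists>H. on_side L H S \<and> on_side L H T)"

text \<open>
  The circles from which \<open>\<delta>\<^sub>1\<close> and \<open>\<delta>\<^sub>2\<close> are taken; \<open>H\<close> is the fixed side of \<open>l\<close>.
\<close>

definition admissible :: "point set \<Rightarrow> point set \<Rightarrow> point set \<Rightarrow> circle \<Rightarrow> circle \<Rightarrow> bool" where
  "admissible k l H \<gamma> \<delta> \<longleftrightarrow>
     radius \<delta> > 0 \<and>
     touches_line \<delta> l \<and> on_side l H (points \<delta>) \<and>
     touches_line \<delta> k \<and> same_side k (points \<gamma>) (points \<delta>) \<and>
     touches_externally \<gamma> \<delta>"

datatype label = Num real | ZeroBar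

fun label_value :: "label \<Rightarrow> real" where
  "label_value (Num x) = x"
| "label_value ZeroBar = 0"

definition tau :: "point set \<Rightarrow> circle \<Rightarrow> point \<Rightarrow> real" where
  "tau l \<delta> K = (if same_side l (points \<delta>) {K} then 1 else - 1)"

text \<open>
  For \<open>K \<noteq> A\<close> the equation \<open>{\<delta>\<^sub>1, \<delta>\<^sub>2} = {\<delta>. \<dots>}\<close> says that \<open>\<delta>\<^sub>1\<close> and \<open>\<delta>\<^sub>2\<close> are the two distinct
  admissible circles, or both equal to the only one. For \<open>K = A\<close> the value of \<open>tau\<close> is irrelevant,
  being multiplied by \<open>dist A K = 0\<close>.
\<close>

definition proper_figure ::
  "point set \<Rightarrow> point set \<Rightarrow> point \<Rightarrow> circle \<Rightarrow> point \<Rightarrow> circle \<Rightarrow> circle \<Rightarrow> label \<Rightarrow> bool" where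
  "proper_figure k l A \<gamma> K \<delta>\<^sub>1 \<delta>\<^sub>2 n \<longleftrightarrow>
     radius \<gamma> > 0 \<and> touches_line_at \<gamma> k K \<and>
     (\<exists>H \<in> components (- l).
        if K = A
        then {\<delta>\<^sub>1} = {\<delta>. admissible k l H \<gamma> \<delta>} \<and> \<delta>\<^sub>2 = Circle A 0
        else {\<delta>\<^sub>1, \<delta>\<^sub>2} = {\<delta>. admissible k l H \<gamma> \<delta>} \<and> radius \<delta>\<^sub>2 \<le> radius \<delta>\<^sub>1) \<and>
     n = Num (tau l \<delta>\<^sub>1 K * dist A K / (2 * radius \<gamma>) + 1 / 2)"

text \<open>
  Once \<open>\<gamma>\<close> is a point it no longer singles out a side of \<open>k\<close>; the common circle
  \<open>\<delta>\<^sub>1 = \<delta>\<^sub>2\<close> may lie on either side of \<open>k\<close>.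
\<close>

definition degenerate_figure ::
  "point set \<Rightarrow> point set \<Rightarrow> point \<Rightarrow> circle \<Rightarrow> point \<Rightarrow> circle \<Rightarrow> circle \<Rightarrow> label \<Rightarrow> bool" where
  "degenerate_figure k l A \<gamma> K \<delta>\<^sub>1 \<delta>\<^sub>2 n \<longleftrightarrow>
     K \<in> k \<and> K \<noteq> A \<and> \<gamma> = Circle K 0 \<and>
     \<delta>\<^sub>1 = \<delta>\<^sub>2 \<and> radius \<delta>\<^sub>1 > 0 \<and>
     (\<exists>H. touches_line \<delta>\<^sub>1 l \<and> on_side l H (points \<delta>\<^sub>1)) \<and>
     touches_line_at \<delta>\<^sub>1 k K \<and>
     n = ZeroBar"

definition figure_T ::
  "point set \<Rightarrow> point set \<Rightarrow> point \<Rightarrow> circle \<Rightarrow> point \<Rightarrow> circle \<Rightarrow> circle \<Rightarrow> label \<Rightarrow> bool" where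
  "figure_T k l A \<gamma> K \<delta>\<^sub>1 \<delta>\<^sub>2 n \<longleftrightarrow>
     is_line k \<and> is_line l \<and> perpendicular k l \<and> k \<inter> l = {A} \<and>
     (proper_figure k l A \<gamma> K \<delta>\<^sub>1 \<delta>\<^sub>2 n \<or> degenerate_figure k l A \<gamma> K \<delta>\<^sub>1 \<delta>\<^sub>2 n)"

end

theory Submission
  imports Defs
begin

text \<open>
  Take unit vectors \<open>u\<close> along \<open>k\<close> and \<open>v\<close> along \<open>l\<close>, with \<open>u\<close> pointing to the fixed side of
  \<open>l\<close> and \<open>v\<close> to the side of \<open>k\<close> that contains \<open>\<gamma>\<close>, and use coordinates with origin \<open>A\<close>. Then
  \<open>\<gamma>\<close> has centre \<open>(a, r)\<close> and touches \<open>k\<close> at \<open>K = (a, 0)\<close>, while a circle of radius \<open>d\<close>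
  that touches both lines from the prescribed sides must have centre \<open>(d, d)\<close>. It touches \<open>\<gamma>\<close>
  externally iff the distance of the centres is \<open>r + d\<close>, that is, iff \<open>(a - d)\<^sup>2 = 4 r d\<close>
  (lemma \<open>admissible_iff\<close>). So the problem is a quadratic equation for \<open>d\<close>.

  The sign \<open>\<tau>\<close> is arranged so that \<open>\<tau> |AK|\<close> is the coordinate \<open>a\<close> (\<open>tau_mult_dist\<close>), whence
  \<open>2 n = (a + r) / r\<close>. A real root exists only if this is nonnegative; with \<open>q = sqrt (2 n)\<close> we
  have \<open>a = r (q\<^sup>2 - 1)\<close>, and the quadratic factors with roots \<open>(q + 1)\<^sup>2 r\<close> and
  \<open>(q - 1)\<^sup>2 r\<close> (\<open>tangency_equation_roots\<close>). The second root vanishes exactly when \<open>a = 0\<close>, where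
  it is represented by the point circle \<open>A\<close>; so the same formulas cover the case \<open>K = A\<close>.
  All three claims can be read off, the case distinction in the last one
  being the sign of \<open>q - 1\<close> in \<open>sqrt d\<^sub>2 = |q - 1| sqrt r\<close>. When \<open>\<gamma>\<close> is a point, \<open>K\<close> has
  distance \<open>d\<^sub>1 = d\<^sub>2\<close> from \<open>A\<close>, because the two points of contact, \<open>A\<close> and the centre form a
  square.

  The work lies in translating the topological descriptions (one common point, sides as
  components of a complement, disjoint discs) into equations between coordinates.
\<close>

section \<open>Circles touching lines and circles\<close>

text \<open>
  The reflection in the foot of the perpendicular from the centre preserves both the circle and the
  line. If they share a single point, that point is fixed by the reflection, hence is the foot.
\<close>

lemma touches_hyperplane_atD:
  fixes v c P :: point
  assumes v: "norm v = 1" and t: "touches_line_at (Circle c r) {x. v \<bullet> x = b} P"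
  shows "\<bar>v \<bullet> c - b\<bar> = r" and "P = c - (v \<bullet> c - b) *\<^sub>R v"
proof -
  have vv: "v \<bullet> v = 1" using v by (simp add: norm_eq_1)
  define F where "F = c - (v \<bullet> c - b) *\<^sub>R v"
  have I: "sphere c r \<inter> {x. v \<bullet> x = b} = {P}"
    using t by (simp add: touches_line_at_def points_def)
  then have "P \<in> sphere c r \<inter> {x. v \<bullet> x = b}" by blast
  then have P: "dist c P = r" "v \<bullet> P = b" by simp_all
  have "(dist c (2 *\<^sub>R F - P))\<^sup>2 = (dist c P)\<^sup>2"
    unfolding F_def dist_norm power2_norm_eq_inner using P(2) vv
    by (simp add: algebra_simps inner_commute)
  then have "dist c (2 *\<^sub>R F - P) = dist c P" by (rule power2_eq_imp_eq) simp_all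
  then have "dist c (2 *\<^sub>R F - P) = r" using P by simp
  moreover have "v \<bullet> (2 *\<^sub>R F - P) = b"
    using P vv by (simp add: F_def algebra_simps)
  ultimately have "2 *\<^sub>R F - P \<in> sphere c r \<inter> {x. v \<bullet> x = b}" by simp
  then have "2 *\<^sub>R F - P = P" unfolding I by simp
  then have "2 *\<^sub>R F = 2 *\<^sub>R P" by (simp add: scaleR_2 algebra_simps)
  then have PF: "P = F" by simp
  then show "P = c - (v \<bullet> c - b) *\<^sub>R v" by (simp add: F_def)
  show "\<bar>v \<bullet> c - b\<bar> = r" using P(1) PF v by (simp add: F_def dist_norm)
qed

text \<open>
  By Pythagoras, a common point of circle and line has distance \<open>0\<close> from the foot of the
  perpendicular when the distance of the centre equals the radius.
\<close>

lemma touches_hyperplane_atI: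
  fixes v c :: point
  assumes v: "norm v = 1" and r: "\<bar>v \<bullet> c - b\<bar> = r"
  shows "touches_line_at (Circle c r) {x. v \<bullet> x = b} (c - (v \<bullet> c - b) *\<^sub>R v)"
proof -
  have vv: "v \<bullet> v = 1" using v by (simp add: norm_eq_1)
  define F where "F = c - (v \<bullet> c - b) *\<^sub>R v"
  have "x = F" if "dist c x = r" "v \<bullet> x = b" for x
  proof -
    have "(norm (x - F))\<^sup>2 = (dist c x)\<^sup>2 - (v \<bullet> c - b)\<^sup>2"
      unfolding F_def dist_norm power2_norm_eq_inner using that(2) vv
      by (simp add: algebra_simps inner_commute power2_eq_square)
    also have "\<dots> = 0" using that r by (metis diff_self power2_abs)
    finally show ?thesis by simp
  qed
  moreover have "dist c F = r" using r v by (simp add: F_def dist_norm)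
  moreover have "v \<bullet> F = b" using vv by (simp add: F_def algebra_simps)
  ultimately have "sphere c r \<inter> {x. v \<bullet> x = b} = {F}" unfolding sphere_def by blast
  then show ?thesis by (simp add: F_def touches_line_at_def points_def)
qed

text \<open>
  A common point gives \<open>dist c e \<le> r + s\<close> by the triangle inequality; if this were strict, the
  point dividing the segment between the centres in the ratio \<open>r : s\<close> would lie in both discs.
  Conversely, when equality holds, that dividing point is common to the circles, and it is the only
  one since every common point yields equality in the triangle inequality.
\<close>

lemma touches_externally_iff_dist:
  assumes r: "r > 0" and s: "s > 0"
  shows "touches_externally (Circle c r) (Circle e s) \<longleftrightarrow> dist c e = r + s"
proof
  assume t: "touches_externally (Circle c r) (Circle e s)"
  then obtain P where "sphere c r \<inter> sphere e s = {P}"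
    by (auto simp: touches_externally_def points_def)
  then have "P \<in> sphere c r \<inter> sphere e s" by blast
  then have "dist c P = r" "dist e P = s" by simp_all
  then have le: "dist c e \<le> r + s" using dist_triangle[of c e P] by (simp add: dist_commute)
  show "dist c e = r + s"
  proof (rule ccontr)
    assume "dist c e \<noteq> r + s"
    with le have less: "dist c e < r + s" by simp
    define q where "q = c + (r / (r + s)) *\<^sub>R (e - c)"
    have "norm (q - c) = r / (r + s) * dist c e"
      using r s by (simp add: q_def dist_norm norm_minus_commute)
    also have "\<dots> < r / (r + s) * (r + s)"
      using r s less by (intro mult_strict_left_mono) auto
    also have "\<dots> = r" using r s by simp
    finally have q_c: "q \<in> ball c r" by (simp add: dist_norm norm_minus_commute)
    have "e - q = (s / (r + s)) *\<^sub>R (e - c)"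
    proof -
      have "s / (r + s) = 1 - r / (r + s)" using r s by (simp add: field_simps)
      then show ?thesis by (simp add: q_def scaleR_left_diff_distrib)
    qed
    then have "norm (e - q) = s / (r + s) * dist c e"
      using r s by (simp add: dist_norm norm_minus_commute)
    also have "\<dots> < s / (r + s) * (r + s)"
      using r s less by (intro mult_strict_left_mono) auto
    also have "\<dots> = s" using r s by simp
    finally have "q \<in> ball e s" by (simp add: dist_norm)
    with q_c show False using t by (auto simp: touches_externally_def)
  qed
next
  assume d: "dist c e = r + s"
  define q where "q = c + (r / (r + s)) *\<^sub>R (e - c)"
  have eq: "e - q = (s / (r + s)) *\<^sub>R (e - c)"
  proof -
    have "s / (r + s) = 1 - r / (r + s)" using r s by (simp add: field_simps)
    then show ?thesis by (simp add: q_def scaleR_left_diff_distrib)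
  qed
  have "dist c q = r"
    using r s d by (simp add: q_def dist_norm norm_minus_commute)
  moreover have "dist e q = s"
    using r s d eq by (simp add: dist_norm norm_minus_commute)
  moreover have "x = q" if x: "dist c x = r" "dist e x = s" for x
  proof -
    have "dist c e = dist c x + dist x e" using x d by (simp add: dist_commute)
    then have "r *\<^sub>R (x - e) = s *\<^sub>R (c - x)"
      using x unfolding dist_triangle_eq by (simp add: dist_norm norm_minus_commute)
    then have "(r + s) *\<^sub>R x = s *\<^sub>R c + r *\<^sub>R e" by (simp add: algebra_simps)
    also have "\<dots> = (r + s) *\<^sub>R c + r *\<^sub>R (e - c)" by (simp add: algebra_simps)
    also have "\<dots> = (r + s) *\<^sub>R q" using r s by (simp add: q_def scaleR_add_right)
    finally show ?thesis using r s by simp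
  qed
  ultimately have "sphere c r \<inter> sphere e s = {q}" unfolding sphere_def by blast
  then have "points (Circle c r) \<inter> points (Circle e s) = {q}" by (simp add: points_def)
  moreover have "ball c r \<inter> ball e s = {}" using d by (intro disjoint_ballI) simp
  ultimately show "touches_externally (Circle c r) (Circle e s)"
    by (auto simp: touches_externally_def)
qed

section \<open>Sides of a line\<close>

text \<open>
  Each open half-plane is convex, hence connected. A connected set avoiding the line cannot meet both
  half-planes, since these are open and disjoint; so they are the maximal connected sets.
\<close>

lemma components_Compl_hyperplane:
  fixes u :: point
  assumes u: "u \<noteq> 0"
  shows "components (- {x. u \<bullet> x = b}) = {{x. u \<bullet> x < b}, {x. u \<bullet> x > b}}"
proof -
  define S N P where "S = - {x. u \<bullet> x = b}" and "N = {x. u \<bullet> x < b}" and "P = {x. u \<bullet> x > b}"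
  have conn: "connected N" "connected P" and "open N" "open P"
    unfolding N_def P_def by (simp_all add: convex_connected convex_halfspace_lt convex_halfspace_gt
        open_halfspace_lt open_halfspace_gt)
  have "u \<bullet> ((t / (u \<bullet> u)) *\<^sub>R u) = t" for t using u by simp
  then have "((b - 1) / (u \<bullet> u)) *\<^sub>R u \<in> N" "((b + 1) / (u \<bullet> u)) *\<^sub>R u \<in> P"
    unfolding N_def P_def mem_Collect_eq by simp_all
  then have ne: "N \<noteq> {}" "P \<noteq> {}" by blast+
  have S: "S = N \<union> P" and disj: "N \<inter> P = {}" by (auto simp: S_def N_def P_def)
  have max: "D \<subseteq> N \<or> D \<subseteq> P" if D: "connected D" "D \<subseteq> S" for D
    using connectedD[OF D(1) \<open>open N\<close> \<open>open P\<close>] D(2) disj S by blast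
  have "N \<in> components S" "P \<in> components S"
    unfolding in_components_maximal using ne conn max S disj by blast+
  moreover have "C = N \<or> C = P" if C: "C \<in> components S" for C
  proof -
    have "C \<subseteq> N \<or> C \<subseteq> P"
      using max C in_components_connected in_components_subset by blast
    then show ?thesis
      using C conn ne S unfolding in_components_maximal by blast
  qed
  ultimately have "components S = {N, P}" by blast
  then show ?thesis by (simp add: S_def N_def P_def)
qed

text \<open>
  Tangency only fixes the absolute value of the signed distance of the centre from the line; its sign
  is read off from the point of the circle opposite to the point of contact. This equation is how
  every condition "touches the line from a given side" is used below.
\<close>

lemma touches_on_positive_side_iff:
  fixes u c :: point
  assumes u: "norm u = 1" and r: "r > 0"
  shows "touches_line (Circle c r) {x. u \<bullet> x = b} \<and>
           on_side {x. u \<bullet> x = b} {x. u \<bullet> x > b} (points (Circle c r)) \<longleftrightarrow> u \<bullet> c - b = r"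
    (is "?T \<and> ?O \<longleftrightarrow> _")
proof
  assume a: "?T \<and> ?O"
  then have abs: "\<bar>u \<bullet> c - b\<bar> = r"
    using touches_hyperplane_atD(1)[OF u] by (auto simp: touches_line_def)
  have "c - r *\<^sub>R u \<in> points (Circle c r)" using u r by (simp add: points_def dist_norm)
  then have "u \<bullet> (c - r *\<^sub>R u) \<ge> b" using a by (auto simp: on_side_def)
  then have "u \<bullet> c - r \<ge> b" using u by (simp add: inner_diff_right norm_eq_1)
  then show "u \<bullet> c - b = r" using abs r by linarith
next
  assume e: "u \<bullet> c - b = r"
  have u0: "u \<noteq> 0" using u by auto
  from e have "?T" using touches_hyperplane_atI[OF u, of c b r] r by (auto simp: touches_line_def)
  moreover have "points (Circle c r) \<subseteq> {x. u \<bullet> x > b} \<union> {x. u \<bullet> x = b}"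
  proof
    fix x assume "x \<in> points (Circle c r)"
    then have "norm (c - x) = r" by (simp add: points_def dist_norm)
    then have "u \<bullet> c - u \<bullet> x \<le> r"
      using Cauchy_Schwarz_ineq2[of u "c - x"] u by (simp add: inner_diff_right)
    then have "b \<le> u \<bullet> x" using e by linarith
    then show "x \<in> {x. u \<bullet> x > b} \<union> {x. u \<bullet> x = b}" by auto
  qed
  then have "?O" by (simp add: on_side_def components_Compl_hyperplane[OF u0])
  ultimately show "?T \<and> ?O" by (rule conjI)
qed

text \<open>
  The circle has a point off the line, namely the one farthest from it, so it cannot lie on both
  sides. This pins down the witness hidden in \<open>same_side\<close>.
\<close>

lemma side_of_circle_unique:
  fixes u c :: point
  assumes u: "norm u = 1" and r: "r > 0" and c: "u \<bullet> c - b = r"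
    and H: "on_side {x. u \<bullet> x = b} H (points (Circle c r))"
  shows "H = {x. u \<bullet> x > b}"
proof -
  have u0: "u \<noteq> 0" using u by auto
  have "c + r *\<^sub>R u \<in> points (Circle c r)" using u r by (simp add: points_def dist_norm)
  then have "c + r *\<^sub>R u \<in> H \<union> {x. u \<bullet> x = b}" using H by (auto simp: on_side_def)
  moreover have "u \<bullet> (c + r *\<^sub>R u) > b" using u r c by (simp add: inner_add_right norm_eq_1)
  moreover have "H \<in> {{x. u \<bullet> x < b}, {x. u \<bullet> x > b}}"
    using H u0 unfolding on_side_def by (simp add: components_Compl_hyperplane)
  ultimately show ?thesis by auto
qed

section \<open>Coordinates along the two perpendicular lines\<close>

locale orthonormal_pair =
  fixes u v :: point
  assumes norm_u: "norm u = 1" and norm_v: "norm v = 1" and orth: "u \<bullet> v = 0"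
begin

lemma inner_simps: "u \<bullet> u = 1" "v \<bullet> v = 1" "u \<bullet> v = 0" "v \<bullet> u = 0"
  using norm_u norm_v orth by (simp_all add: norm_eq_1 inner_commute)

lemma expansion: "x = (u \<bullet> x) *\<^sub>R u + (v \<bullet> x) *\<^sub>R v"
proof -
  have ne: "u \<noteq> v" using inner_simps by auto
  have orthp: "pairwise orthogonal {u, v}"
    using inner_simps by (auto simp: pairwise_def orthogonal_def)
  have "independent {u, v}"
    using orthp norm_u norm_v by (intro pairwise_orthogonal_independent) auto
  then have "UNIV \<subseteq> span {u, v}"
    using ne by (intro card_ge_dim_independent) auto
  then have "(\<Sum>i\<in>{u, v}. (x \<bullet> i) *\<^sub>R i) = x"
    using norm_u norm_v by (intro orthonormal_basis_expand[OF orthp]) auto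
  then show ?thesis using ne by (simp add: inner_commute)
qed

lemma dist_squared: "(dist x y)\<^sup>2 = (u \<bullet> x - u \<bullet> y)\<^sup>2 + (v \<bullet> x - v \<bullet> y)\<^sup>2"
proof -
  have "(norm z)\<^sup>2 = (u \<bullet> z)\<^sup>2 + (v \<bullet> z)\<^sup>2" for z
    unfolding power2_norm_eq_inner
    by (subst (1 2) expansion[of z]) (simp add: inner_simps inner_add_left inner_add_right power2_eq_square)
  then show ?thesis by (simp add: dist_norm inner_diff_right)
qed

lemma eqI: "u \<bullet> x = u \<bullet> y \<Longrightarrow> v \<bullet> x = v \<bullet> y \<Longrightarrow> x = y"
  using dist_squared[of x y] by simp

lemma dist_parallel:
  assumes "v \<bullet> x = v \<bullet> y"
  shows "dist x y = \<bar>u \<bullet> y - u \<bullet> x\<bar>"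
proof -
  have "(dist x y)\<^sup>2 = \<bar>u \<bullet> y - u \<bullet> x\<bar>\<^sup>2"
    using assms by (simp add: dist_squared power2_commute)
  then show ?thesis by (rule power2_eq_imp_eq) auto
qed

text \<open>
  Touching both lines from the prescribed sides puts the centre at \<open>(d, d)\<close>, and the squared
  tangency condition \<open>(a - d)\<^sup>2 + (r - d)\<^sup>2 = (r + d)\<^sup>2\<close> simplifies to \<open>(a - d)\<^sup>2 = 4 r d\<close>.
\<close>

lemma admissible_iff:
  assumes r: "r > 0" and g: "v \<bullet> g - v \<bullet> A = r"
  shows "admissible {x. v \<bullet> x = v \<bullet> A} {x. u \<bullet> x = u \<bullet> A} {x. u \<bullet> x > u \<bullet> A} (Circle g r) \<delta> \<longleftrightarrow>
    (\<exists>d>0. \<delta> = Circle (A + d *\<^sub>R (u + v)) d \<and> ((u \<bullet> g - u \<bullet> A) - d)\<^sup>2 = 4 * r * d)"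
    (is "admissible ?k ?l ?H _ _ \<longleftrightarrow> _")
proof -
  let ?a = "u \<bullet> g - u \<bullet> A"
  have tangency: "touches_externally (Circle g r) (Circle (A + d *\<^sub>R (u + v)) d)
      \<longleftrightarrow> (?a - d)\<^sup>2 = 4 * r * d" if d: "d > 0" for d
  proof -
    let ?c = "A + d *\<^sub>R (u + v)"
    have "dist g ?c = r + d \<longleftrightarrow> (dist g ?c)\<^sup>2 = (r + d)\<^sup>2"
      using r d by (simp add: power2_eq_iff_nonneg)
    also have "(dist g ?c)\<^sup>2 = (?a - d)\<^sup>2 + (r - d)\<^sup>2"
      unfolding dist_squared using g by (simp add: inner_simps algebra_simps)
    also have "\<dots> = (r + d)\<^sup>2 \<longleftrightarrow> (?a - d)\<^sup>2 = 4 * r * d"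
      by (simp add: power2_eq_square algebra_simps)
    finally show ?thesis using touches_externally_iff_dist[OF r d] by simp
  qed
  have side_g: "on_side ?k {x. v \<bullet> x > v \<bullet> A} (points (Circle g r))"
    using touches_on_positive_side_iff[OF norm_v r, of g "v \<bullet> A"] g by blast
  show ?thesis
  proof
    assume a: "admissible ?k ?l ?H (Circle g r) \<delta>"
    obtain c d where \<delta>: "\<delta> = Circle c d" by (cases \<delta>)
    have d: "d > 0" using a \<delta> by (simp add: admissible_def)
    have uc: "u \<bullet> c - u \<bullet> A = d"
      using a touches_on_positive_side_iff[OF norm_u d, of c "u \<bullet> A"] by (simp add: admissible_def \<delta>)
    have "on_side ?k {x. v \<bullet> x > v \<bullet> A} (points \<delta>)"
      using a side_of_circle_unique[OF norm_v r g] by (auto simp: admissible_def same_side_def)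
    then have vc: "v \<bullet> c - v \<bullet> A = d"
      using a touches_on_positive_side_iff[OF norm_v d, of c "v \<bullet> A"] by (simp add: admissible_def \<delta>)
    have "c = A + d *\<^sub>R (u + v)"
      using uc vc by (intro eqI) (simp_all add: inner_simps algebra_simps)
    with a d tangency show "\<exists>d>0. \<delta> = Circle (A + d *\<^sub>R (u + v)) d \<and> (?a - d)\<^sup>2 = 4 * r * d"
      by (auto simp: admissible_def \<delta>)
  next
    assume "\<exists>d>0. \<delta> = Circle (A + d *\<^sub>R (u + v)) d \<and> (?a - d)\<^sup>2 = 4 * r * d"
    then obtain d where d: "d > 0" and \<delta>: "\<delta> = Circle (A + d *\<^sub>R (u + v)) d"
      and e: "(?a - d)\<^sup>2 = 4 * r * d" by blast
    let ?c = "A + d *\<^sub>R (u + v)"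
    have "u \<bullet> ?c - u \<bullet> A = d" "v \<bullet> ?c - v \<bullet> A = d"
      by (simp_all add: inner_simps algebra_simps)
    then have "touches_line \<delta> ?l" "on_side ?l ?H (points \<delta>)"
      and "touches_line \<delta> ?k" "on_side ?k {x. v \<bullet> x > v \<bullet> A} (points \<delta>)"
      using touches_on_positive_side_iff[OF norm_u d, of ?c "u \<bullet> A"]
        touches_on_positive_side_iff[OF norm_v d, of ?c "v \<bullet> A"] by (simp_all add: \<delta>)
    moreover have "touches_externally (Circle g r) \<delta>" using tangency[OF d] e by (simp only: \<delta>)
    moreover have "radius \<delta> > 0" using d by (simp add: \<delta>)
    ultimately show "admissible ?k ?l ?H (Circle g r) \<delta>"
      using side_g unfolding admissible_def same_side_def by blast
  qed
qed

text \<open>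
  The sign \<open>tau\<close> turns the distance into the signed coordinate of \<open>K\<close> along \<open>k\<close>, because any
  circle touching \<open>l\<close> from the positive side singles out that side. At \<open>K = A\<close> both sides of the
  equation are \<open>0\<close>.
\<close>

lemma tau_mult_dist:
  assumes d: "d > 0" and c: "u \<bullet> c - u \<bullet> A = d" and K: "v \<bullet> K = v \<bullet> A"
  shows "tau {x. u \<bullet> x = u \<bullet> A} (Circle c d) K * dist A K = u \<bullet> K - u \<bullet> A"
proof -
  let ?l = "{x. u \<bullet> x = u \<bullet> A}"
  have dist: "dist A K = \<bar>u \<bullet> K - u \<bullet> A\<bar>"
    using dist_parallel K by simp
  have side: "on_side ?l {x. u \<bullet> x > u \<bullet> A} (points (Circle c d))"
    using touches_on_positive_side_iff[OF norm_u d, of c "u \<bullet> A"] c by blast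
  then have "same_side ?l (points (Circle c d)) {K} \<longleftrightarrow> on_side ?l {x. u \<bullet> x > u \<bullet> A} {K}"
    using side_of_circle_unique[OF norm_u d c] unfolding same_side_def by metis
  moreover have "on_side ?l {x. u \<bullet> x > u \<bullet> A} {K} \<longleftrightarrow> u \<bullet> K \<ge> u \<bullet> A"
    using side by (auto simp: on_side_def)
  ultimately have "same_side ?l (points (Circle c d)) {K} \<longleftrightarrow> u \<bullet> K \<ge> u \<bullet> A" by blast
  then show ?thesis using dist by (auto simp: tau_def)
qed

end

lemma unit_direction_of_line:
  assumes "is_line k" "A \<in> k"
  obtains w where "norm w = 1" "\<And>s. A + s *\<^sub>R w \<in> k"
proof -
  have "k \<noteq> {A}" using assms by (auto simp: is_line_def)
  then obtain B where B: "B \<in> k" "B \<noteq> A" using assms by blast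
  define w where "w = (1 / norm (B - A)) *\<^sub>R (B - A)"
  have "A + s *\<^sub>R w \<in> k" for s
  proof -
    have "(1 - s / norm (B - A)) *\<^sub>R A + (s / norm (B - A)) *\<^sub>R B \<in> k"
      using assms B by (intro mem_affine) (auto simp: is_line_def)
    then show ?thesis by (simp add: w_def algebra_simps)
  qed
  moreover have "norm w = 1" using B by (simp add: w_def)
  ultimately show ?thesis using that by blast
qed

text \<open>
  Unit directions of the two lines form an orthonormal basis, and replacing a vector by its negative
  changes the orientation but not the line. This allows the side \<open>H\<close> of \<open>l\<close> and the side of \<open>k\<close>
  containing the point \<open>g\<close> (later the centre of a circle) to be taken as the positive ones.
\<close>

lemma adapted_frame:
  fixes g :: point
  assumes lines: "is_line k" "is_line l" "perpendicular k l" "k \<inter> l = {A}"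
    and H: "H \<in> components (- l)"
  obtains u v where "orthonormal_pair u v"
    "k = {x. v \<bullet> x = v \<bullet> A}" "l = {x. u \<bullet> x = u \<bullet> A}"
    "H = {x. u \<bullet> x > u \<bullet> A}" "v \<bullet> g \<ge> v \<bullet> A"
proof -
  have A: "A \<in> k" "A \<in> l" using lines by auto
  obtain u where u: "norm u = 1" "\<And>s. A + s *\<^sub>R u \<in> k" using unit_direction_of_line lines A by metis
  obtain v where v: "norm v = 1" "\<And>s. A + s *\<^sub>R v \<in> l" using unit_direction_of_line lines A by metis
  have perp: "(x - A) \<bullet> (y - A) = 0" if "x \<in> k" "y \<in> l" for x y
    using lines A that by (auto simp: perpendicular_def orthogonal_def)
  interpret orthonormal_pair u v
    using u v perp[OF u(2)[of 1] v(2)[of 1]] by unfold_locales auto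
  have k: "k = {x. v \<bullet> x = v \<bullet> A}"
  proof safe
    fix x assume "x \<in> k"
    from perp[OF this v(2)[of 1]] show "v \<bullet> x = v \<bullet> A" by (simp add: inner_diff_left inner_diff_right inner_commute)
  next
    fix x assume "v \<bullet> x = v \<bullet> A"
    then have "x = A + (u \<bullet> x - u \<bullet> A) *\<^sub>R u"
      by (intro eqI) (simp_all add: inner_simps inner_add_right)
    then show "x \<in> k" using u(2) by metis
  qed
  have l: "l = {x. u \<bullet> x = u \<bullet> A}"
  proof safe
    fix x assume "x \<in> l"
    from perp[OF u(2)[of 1] this] show "u \<bullet> x = u \<bullet> A" by (simp add: inner_diff_right)
  next
    fix x assume "u \<bullet> x = u \<bullet> A"
    then have "x = A + (v \<bullet> x - v \<bullet> A) *\<^sub>R v"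
      by (intro eqI) (simp_all add: inner_simps inner_add_right)
    then show "x \<in> l" using v(2) by metis
  qed
  have u0: "u \<noteq> 0" using norm_u by auto
  define u' where "u' = (if H = {x. u \<bullet> x > u \<bullet> A} then u else - u)"
  define v' where "v' = (if v \<bullet> g \<ge> v \<bullet> A then v else - v)"
  have "H = {x. u \<bullet> x < u \<bullet> A} \<or> H = {x. u \<bullet> x > u \<bullet> A}"
    using H u0 unfolding l by (simp add: components_Compl_hyperplane)
  then have "H = {x. u' \<bullet> x > u' \<bullet> A}" by (auto simp: u'_def)
  moreover have "orthonormal_pair u' v'"
    using norm_u norm_v orth by unfold_locales (auto simp: u'_def v'_def)
  moreover have "k = {x. v' \<bullet> x = v' \<bullet> A}" "l = {x. u' \<bullet> x = u' \<bullet> A}" "v' \<bullet> g \<ge> v' \<bullet> A"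
    by (auto simp: k l u'_def v'_def)
  ultimately show ?thesis using that by blast
qed

section \<open>The radii\<close>

text \<open>
  The substitution \<open>a = r (q\<^sup>2 - 1)\<close> makes the discriminant \<open>16 r (a + r)\<close> of the tangency equation
  the perfect square \<open>(4 r q)\<^sup>2\<close>.
\<close>

lemma tangency_equation_roots:
  fixes r q d :: real
  assumes "r > 0"
  shows "(r * (q\<^sup>2 - 1) - d)\<^sup>2 = 4 * r * d \<longleftrightarrow> d = (q + 1)\<^sup>2 * r \<or> d = (q - 1)\<^sup>2 * r"
proof -
  have "(r * (q\<^sup>2 - 1) - d)\<^sup>2 - 4 * r * d = (d - (q + 1)\<^sup>2 * r) * (d - (q - 1)\<^sup>2 * r)"
    by (simp add: power2_eq_square algebra_simps)
  then show ?thesis by (metis eq_iff_diff_eq_0 mult_eq_0_iff)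
qed

text \<open>
  Here \<open>q\<close> is \<open>sqrt (2 n)\<close>. The mere existence of an admissible circle forces \<open>a + r \<ge> 0\<close>, so that
  \<open>q\<close> is real. The set of admissible circles determines the set of the two radii,
  and the order of the radii says which is which.
\<close>

lemma proper_radii:
  assumes lines: "is_line k" "is_line l" "perpendicular k l" "k \<inter> l = {A}"
    and fig: "proper_figure k l A \<gamma> K \<delta>\<^sub>1 \<delta>\<^sub>2 n"
  obtains q where "q \<ge> 0" "n = Num (q\<^sup>2 / 2)" "dist A K = radius \<gamma> * \<bar>q\<^sup>2 - 1\<bar>"
    "radius \<delta>\<^sub>1 = (q + 1)\<^sup>2 * radius \<gamma>" "radius \<delta>\<^sub>2 = (q - 1)\<^sup>2 * radius \<gamma>"
proof -
  obtain g r where \<gamma>: "\<gamma> = Circle g r" by (cases \<gamma>)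
  have r: "r > 0" and tK: "touches_line_at (Circle g r) k K"
    and n: "n = Num (tau l \<delta>\<^sub>1 K * dist A K / (2 * r) + 1 / 2)"
    using fig by (auto simp: proper_figure_def \<gamma>)
  obtain H where H: "H \<in> components (- l)" and adm:
    "if K = A then {\<delta>\<^sub>1} = {\<delta>. admissible k l H \<gamma> \<delta>} \<and> \<delta>\<^sub>2 = Circle A 0
     else {\<delta>\<^sub>1, \<delta>\<^sub>2} = {\<delta>. admissible k l H \<gamma> \<delta>} \<and> radius \<delta>\<^sub>2 \<le> radius \<delta>\<^sub>1"
    using fig by (auto simp: proper_figure_def)
  obtain u v where "orthonormal_pair u v" and k: "k = {x. v \<bullet> x = v \<bullet> A}"
    and l: "l = {x. u \<bullet> x = u \<bullet> A}" and Hu: "H = {x. u \<bullet> x > u \<bullet> A}" and vg: "v \<bullet> g \<ge> v \<bullet> A"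
    using adapted_frame[OF lines H] by metis
  interpret orthonormal_pair u v by fact
  define a where "a = u \<bullet> g - u \<bullet> A"
  have g: "v \<bullet> g - v \<bullet> A = r" and Kg: "K = g - r *\<^sub>R v"
    using touches_hyperplane_atD[OF norm_v tK[unfolded k]] vg by auto
  have K: "v \<bullet> K = v \<bullet> A" "u \<bullet> K - u \<bullet> A = a"
    using g by (simp_all add: Kg a_def inner_simps inner_diff_right)
  have distK: "dist A K = \<bar>a\<bar>"
    using dist_parallel[of A K] K by simp
  then have KA: "K = A \<longleftrightarrow> a = 0" by auto
  have adm_iff: "admissible k l H \<gamma> \<delta> \<longleftrightarrow>
      (\<exists>d>0. \<delta> = Circle (A + d *\<^sub>R (u + v)) d \<and> (a - d)\<^sup>2 = 4 * r * d)" for \<delta>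
    unfolding k l Hu \<gamma> a_def by (rule admissible_iff[OF r g])
  have "\<delta>\<^sub>1 \<in> {\<delta>. admissible k l H \<gamma> \<delta>}" using adm by (auto split: if_splits)
  then obtain d\<^sub>1 where d\<^sub>1: "d\<^sub>1 > 0" "\<delta>\<^sub>1 = Circle (A + d\<^sub>1 *\<^sub>R (u + v)) d\<^sub>1" "(a - d\<^sub>1)\<^sup>2 = 4 * r * d\<^sub>1"
    using adm_iff by auto
  have "tau l \<delta>\<^sub>1 K * dist A K = a"
    using tau_mult_dist[OF d\<^sub>1(1) _ K(1), of "A + d\<^sub>1 *\<^sub>R (u + v)"] K(2)
    by (simp add: l d\<^sub>1(2) inner_simps algebra_simps)
  then have n': "n = Num ((a + r) / r / 2)" using n r by (simp add: field_simps)
  \<comment> \<open>completing the square in the tangency equation\<close>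
  have "4 * r * (a + r) = (d\<^sub>1 - (a + 2 * r))\<^sup>2"
    using d\<^sub>1(3) by (simp add: power2_eq_square algebra_simps)
  then have "a + r \<ge> 0" using r
    by (metis mult_pos_pos zero_le_mult_iff zero_le_power2 zero_less_numeral not_less)
  define q where "q = sqrt ((a + r) / r)"
  have q: "q \<ge> 0" "q\<^sup>2 = (a + r) / r" using r \<open>a + r \<ge> 0\<close> by (auto simp: q_def)
  have aq: "a = r * (q\<^sup>2 - 1)" using q r by (simp add: field_simps)
  have root: "(a - d)\<^sup>2 = 4 * r * d \<longleftrightarrow> d = (q + 1)\<^sup>2 * r \<or> d = (q - 1)\<^sup>2 * r" for d
    unfolding aq by (rule tangency_equation_roots[OF r])
  have big: "(q + 1)\<^sup>2 * r > 0" using q r by simp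
  have radii: "radius \<delta>\<^sub>1 = (q + 1)\<^sup>2 * r \<and> radius \<delta>\<^sub>2 = (q - 1)\<^sup>2 * r"
  proof (cases "K = A")
    case True
    then have "q\<^sup>2 = 1" using KA aq r by simp
    \<comment> \<open>the roots are \<open>4 r\<close> and \<open>0\<close>; only the former is the radius of an admissible circle\<close>
    then have "q = 1" using q by (simp add: power2_eq_1_iff)
    then show ?thesis using adm True d\<^sub>1 root by auto
  next
    case False
    then have "q \<noteq> 1" using KA aq by auto
    \<comment> \<open>so both roots are radii of admissible circles\<close>
    then have small: "(q - 1)\<^sup>2 * r > 0" using r by simp
    have "radius ` {\<delta>. admissible k l H \<gamma> \<delta>} = {d. d > 0 \<and> (a - d)\<^sup>2 = 4 * r * d}"
      unfolding adm_iff by (force simp: image_iff)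
    also have "\<dots> = {(q + 1)\<^sup>2 * r, (q - 1)\<^sup>2 * r}" using root big small by auto
    finally have "{radius \<delta>\<^sub>1, radius \<delta>\<^sub>2} = {(q + 1)\<^sup>2 * r, (q - 1)\<^sup>2 * r}"
      using adm False by (metis image_empty image_insert)
    moreover have "(q - 1)\<^sup>2 * r \<le> (q + 1)\<^sup>2 * r"
      using q r by (intro mult_right_mono) (auto simp: power2_eq_square algebra_simps)
    moreover have "radius \<delta>\<^sub>2 \<le> radius \<delta>\<^sub>1" using adm False by simp
    ultimately show ?thesis by (auto simp: doubleton_eq_iff)
  qed
  have "\<bar>a\<bar> = r * \<bar>q\<^sup>2 - 1\<bar>" using r by (subst aq) (simp add: abs_mult)
  then have AK: "dist A K = radius \<gamma> * \<bar>q\<^sup>2 - 1\<bar>" using distK by (simp add: \<gamma>)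
  have "n = Num (q\<^sup>2 / 2)" using n' q(2) by simp
  then show ?thesis using that[OF q(1) _ AK] radii by (simp add: \<gamma>)
qed

text \<open>
  The centre is \<open>(d, d)\<close> and \<open>K\<close> is its projection to \<open>k\<close>. Orienting the frame by \<open>\<delta>\<^sub>1\<close> itself
  covers both sides of \<open>k\<close> on which the circle may lie.
\<close>

lemma degenerate_radii:
  assumes lines: "is_line k" "is_line l" "perpendicular k l" "k \<inter> l = {A}"
    and fig: "degenerate_figure k l A \<gamma> K \<delta>\<^sub>1 \<delta>\<^sub>2 n"
  shows "dist A K = radius \<delta>\<^sub>1"
proof -
  obtain c d where \<delta>: "\<delta>\<^sub>1 = Circle c d" by (cases \<delta>\<^sub>1)
  have d: "d > 0" and t: "touches_line_at (Circle c d) k K"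
    using fig by (auto simp: degenerate_figure_def \<delta>)
  obtain H where tl: "touches_line (Circle c d) l" and H: "on_side l H (points (Circle c d))"
    using fig by (auto simp: degenerate_figure_def \<delta>)
  have "H \<in> components (- l)" using H by (simp add: on_side_def)
  then obtain u v where "orthonormal_pair u v" and k: "k = {x. v \<bullet> x = v \<bullet> A}"
    and l: "l = {x. u \<bullet> x = u \<bullet> A}" and Hu: "H = {x. u \<bullet> x > u \<bullet> A}" and vc: "v \<bullet> c \<ge> v \<bullet> A"
    using adapted_frame[OF lines] by metis
  interpret orthonormal_pair u v by fact
  have v: "v \<bullet> c - v \<bullet> A = d" and K: "K = c - d *\<^sub>R v"
    using touches_hyperplane_atD[OF norm_v t[unfolded k]] vc by auto
  have "u \<bullet> c - u \<bullet> A = d"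
    using touches_on_positive_side_iff[OF norm_u d, of c "u \<bullet> A"] tl H by (simp add: l Hu)
  then show ?thesis
    using dist_parallel[of A K] v d by (simp add: \<delta> K inner_simps inner_diff_right)
qed

theorem theorem3p1:
  fixes k l :: "point set" and A K :: point
    and \<gamma> \<delta>\<^sub>1 \<delta>\<^sub>2 :: circle and n :: label and r d\<^sub>1 d\<^sub>2 :: real
  assumes "figure_T k l A \<gamma> K \<delta>\<^sub>1 \<delta>\<^sub>2 n"
    and "r = radius \<gamma>" and "d\<^sub>1 = radius \<delta>\<^sub>1" and "d\<^sub>2 = radius \<delta>\<^sub>2"
  shows "(n \<noteq> ZeroBar \<longrightarrow>
            d\<^sub>1 = (sqrt (2 * label_value n) + 1)\<^sup>2 * r \<and>
            d\<^sub>2 = (sqrt (2 * label_value n) - 1)\<^sup>2 * r) \<and>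
         dist A K = sqrt (d\<^sub>1 * d\<^sub>2) \<and>
         (n \<noteq> ZeroBar \<and> 0 \<le> label_value n \<and> label_value n \<le> 1 / 2 \<longrightarrow>
            sqrt r = (sqrt d\<^sub>1 + sqrt d\<^sub>2) / 2) \<and>
         (1 / 2 < label_value n \<or> n = ZeroBar \<longrightarrow>
            sqrt r = (sqrt d\<^sub>1 - sqrt d\<^sub>2) / 2)"
proof -
  have lines: "is_line k" "is_line l" "perpendicular k l" "k \<inter> l = {A}"
    using assms(1) by (auto simp: figure_T_def)
  consider "proper_figure k l A \<gamma> K \<delta>\<^sub>1 \<delta>\<^sub>2 n" | "degenerate_figure k l A \<gamma> K \<delta>\<^sub>1 \<delta>\<^sub>2 n"
    using assms(1) by (auto simp: figure_T_def)
  then show ?thesis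
  proof cases
    case 1
    then have r: "r > 0" by (simp add: proper_figure_def assms)
    obtain q where q: "q \<ge> 0" and n: "n = Num (q\<^sup>2 / 2)" and AK: "dist A K = r * \<bar>q\<^sup>2 - 1\<bar>"
      and d: "d\<^sub>1 = (q + 1)\<^sup>2 * r" "d\<^sub>2 = (q - 1)\<^sup>2 * r"
      using proper_radii[OF lines 1] unfolding assms by metis
    have sq: "sqrt (2 * label_value n) = q" using q by (simp add: n)
    have "d\<^sub>1 * d\<^sub>2 = (r * (q\<^sup>2 - 1))\<^sup>2" by (simp add: d power2_eq_square algebra_simps)
    then have "dist A K = sqrt (d\<^sub>1 * d\<^sub>2)" using AK r by (simp add: abs_mult)
    moreover have sqrts: "sqrt d\<^sub>1 = (q + 1) * sqrt r" "sqrt d\<^sub>2 = \<bar>q - 1\<bar> * sqrt r"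
      using q by (simp_all add: d real_sqrt_mult)
    moreover have "label_value n \<le> 1 / 2 \<longleftrightarrow> q \<le> 1"
      using q power2_le_iff_abs_le[of 1 q] by (simp add: n)
    ultimately show ?thesis
      using d sq by (auto simp: n algebra_simps)
  next
    case 2
    then have "r = 0" "d\<^sub>1 = d\<^sub>2" "d\<^sub>1 > 0" "n = ZeroBar" by (auto simp: degenerate_figure_def assms)
    then show ?thesis using degenerate_radii[OF lines 2] assms by simp
  qed
qed

end
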